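(* Each of the normal modal logics $\mathsf{K}$, $\mathsf{D}$, $\mathsf{KT}$, $\mathsf{K4}$, $\mathsf{KD4}$, $\mathsf{S4}$, $\mathsf{GL}$ has both the modal disjunctive interpolation property $\mathrm{MDIP}$ and its monotone version $\mathrm{mMDIP}$.
   Context: Modal formulas are over $\{\top,\bot,\wedge,\vee,\to,\Box\}$; $V(\phi)$ is the set of atoms of $\phi$; a formula is monotone if it contains no implication (so no negation, as $\neg\phi:=\phi\to\bot$). For a modal logic $L$, an $L$-modal disjunctive interpolant ($L$-MDI) for $(\phi\to\Box\psi\vee\Box\theta)\in L$ is a pair $(I,J)$ with $V(I),V(J)\subseteq V(\phi)$ such that $\phi\to(I\vee J)$, $I\to\Box\psi$ and $J\to\Box\theta$ are in $L$; an $L$-mMDI additionally requires $\phi$, $I$, $J$ monotone. $L$ has MDIP if every such formula in $L$ has an $L$-MDI, and mMDIP if every such formula in $L$ with $\phi$ monotone has an $L$-mMDI. *)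

theory Defs
  imports Main
begin

datatype fm =
    Atom nat
  | Top
  | Bot
  | Conj fm fm (infixr "\<^bold>\<and>" 65)
  | Disj fm fm (infixr "\<^bold>\<or>" 60)
  | Imp fm fm (infixr "\<^bold>\<rightarrow>" 55)
  | Box fm ("\<^bold>\<box> _" [80] 80)

abbreviation Neg :: "fm \<Rightarrow> fm" ("\<^bold>\<not> _" [80] 80) where
  "\<^bold>\<not> A \<equiv> A \<^bold>\<rightarrow> Bot"

abbreviation Dia :: "fm \<Rightarrow> fm" ("\<^bold>\<diamond> _" [80] 80) where
  "\<^bold>\<diamond> A \<equiv> \<^bold>\<not> (\<^bold>\<box> (\<^bold>\<not> A))"

primrec V :: "fm \<Rightarrow> nat set" where
  "V (Atom p) = {p}"
| "V Top = {}"
| "V Bot = {}"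
| "V (A \<^bold>\<and> B) = V A \<union> V B"
| "V (A \<^bold>\<or> B) = V A \<union> V B"
| "V (A \<^bold>\<rightarrow> B) = V A \<union> V B"
| "V (\<^bold>\<box> A) = V A"

primrec monotone_fm :: "fm \<Rightarrow> bool" where
  "monotone_fm (Atom p) \<longleftrightarrow> True"
| "monotone_fm Top \<longleftrightarrow> True"
| "monotone_fm Bot \<longleftrightarrow> True"
| "monotone_fm (A \<^bold>\<and> B) \<longleftrightarrow> monotone_fm A \<and> monotone_fm B"
| "monotone_fm (A \<^bold>\<or> B) \<longleftrightarrow> monotone_fm A \<and> monotone_fm B"
| "monotone_fm (A \<^bold>\<rightarrow> B) \<longleftrightarrow> False"
| "monotone_fm (\<^bold>\<box> A) \<longleftrightarrow> monotone_fm A"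

text \<open>Truth-functional evaluation: atoms (through \<open>a\<close>) and boxed formulas (through \<open>b\<close>) receive
  arbitrary truth values, so the formulas true under all \<open>a\<close>, \<open>b\<close> are exactly the substitution
  instances of classical propositional tautologies.\<close>

primrec prop_eval :: "(nat \<Rightarrow> bool) \<Rightarrow> (fm \<Rightarrow> bool) \<Rightarrow> fm \<Rightarrow> bool" where
  "prop_eval a b (Atom p) \<longleftrightarrow> a p"
| "prop_eval a b Top \<longleftrightarrow> True"
| "prop_eval a b Bot \<longleftrightarrow> False"
| "prop_eval a b (A \<^bold>\<and> B) \<longleftrightarrow> prop_eval a b A \<and> prop_eval a b B"
| "prop_eval a b (A \<^bold>\<or> B) \<longleftrightarrow> prop_eval a b A \<or> prop_eval a b B"
| "prop_eval a b (A \<^bold>\<rightarrow> B) \<longleftrightarrow> (prop_eval a b A \<longrightarrow> prop_eval a b B)"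
| "prop_eval a b (\<^bold>\<box> A) \<longleftrightarrow> b A"

definition tautology :: "fm \<Rightarrow> bool" where
  "tautology A \<longleftrightarrow> (\<forall>a b. prop_eval a b A)"

text \<open>The least normal modal logic containing \<open>Ax\<close>.  There is no substitution rule: all axiom
  sets used below are schemata, i.e. closed under substitution, and hence so is the logic.\<close>

inductive_set normal_logic :: "fm set \<Rightarrow> fm set" for Ax :: "fm set" where
  Taut: "tautology A \<Longrightarrow> A \<in> normal_logic Ax"
| Distr: "\<^bold>\<box> (A \<^bold>\<rightarrow> B) \<^bold>\<rightarrow> \<^bold>\<box> A \<^bold>\<rightarrow> \<^bold>\<box> B \<in> normal_logic Ax"
| Axiom: "A \<in> Ax \<Longrightarrow> A \<in> normal_logic Ax"
| MP: "A \<^bold>\<rightarrow> B \<in> normal_logic Ax \<Longrightarrow> A \<in> normal_logic Ax \<Longrightarrow> B \<in> normal_logic Ax"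
| Nec: "A \<in> normal_logic Ax \<Longrightarrow> \<^bold>\<box> A \<in> normal_logic Ax"

definition ax_D :: "fm set" where "ax_D = {\<^bold>\<box> A \<^bold>\<rightarrow> \<^bold>\<diamond> A | A. True}"
definition ax_T :: "fm set" where "ax_T = {\<^bold>\<box> A \<^bold>\<rightarrow> A | A. True}"
definition ax_4 :: "fm set" where "ax_4 = {\<^bold>\<box> A \<^bold>\<rightarrow> \<^bold>\<box> \<^bold>\<box> A | A. True}"
definition ax_L :: "fm set" where "ax_L = {\<^bold>\<box> (\<^bold>\<box> A \<^bold>\<rightarrow> A) \<^bold>\<rightarrow> \<^bold>\<box> A | A. True}"

definition logic_K :: "fm set" where "logic_K = normal_logic {}"
definition logic_D :: "fm set" where "logic_D = normal_logic ax_D"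
definition logic_KT :: "fm set" where "logic_KT = normal_logic ax_T"
definition logic_K4 :: "fm set" where "logic_K4 = normal_logic ax_4"
definition logic_KD4 :: "fm set" where "logic_KD4 = normal_logic (ax_D \<union> ax_4)"
definition logic_S4 :: "fm set" where "logic_S4 = normal_logic (ax_T \<union> ax_4)"
definition logic_GL :: "fm set" where "logic_GL = normal_logic ax_L"

definition is_MDI :: "fm set \<Rightarrow> fm \<Rightarrow> fm \<Rightarrow> fm \<Rightarrow> fm \<times> fm \<Rightarrow> bool" where
  "is_MDI L \<phi> \<psi> \<theta> = (\<lambda>(I, J).
     V I \<subseteq> V \<phi> \<and> V J \<subseteq> V \<phi> \<and>
     \<phi> \<^bold>\<rightarrow> (I \<^bold>\<or> J) \<in> L \<and> I \<^bold>\<rightarrow> \<^bold>\<box> \<psi> \<in> L \<and> J \<^bold>\<rightarrow> \<^bold>\<box> \<theta> \<in> L)"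

definition is_mMDI :: "fm set \<Rightarrow> fm \<Rightarrow> fm \<Rightarrow> fm \<Rightarrow> fm \<times> fm \<Rightarrow> bool" where
  "is_mMDI L \<phi> \<psi> \<theta> = (\<lambda>(I, J).
     is_MDI L \<phi> \<psi> \<theta> (I, J) \<and> monotone_fm \<phi> \<and> monotone_fm I \<and> monotone_fm J)"

definition MDIP :: "fm set \<Rightarrow> bool" where
  "MDIP L \<longleftrightarrow> (\<forall>\<phi> \<psi> \<theta>. \<phi> \<^bold>\<rightarrow> (\<^bold>\<box> \<psi> \<^bold>\<or> \<^bold>\<box> \<theta>) \<in> L \<longrightarrow>
     (\<exists>I J. is_MDI L \<phi> \<psi> \<theta> (I, J)))"

definition mMDIP :: "fm set \<Rightarrow> bool" where
  "mMDIP L \<longleftrightarrow> (\<forall>\<phi> \<psi> \<theta>. \<phi> \<^bold>\<rightarrow> (\<^bold>\<box> \<psi> \<^bold>\<or> \<^bold>\<box> \<theta>) \<in> L \<longrightarrow> monotone_fm \<phi> \<longrightarrow>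
     (\<exists>I J. is_mMDI L \<phi> \<psi> \<theta> (I, J)))"

end

theory Submission
  imports Defs
begin

text \<open>Decompose \<open>\<phi>\<close> into the disjunction of the diagrams \<open>\<delta>\<close> of the truth assignments to its
  subformulas that make \<open>\<phi>\<close> true; a diagram lists the true subformulas and, unless a monotone
  interpolant is wanted, the negations of the false ones.  Each \<open>\<delta>\<close> has the modal disjunction
  property: if it implies \<open>\<box>\<psi> \<or> \<box>\<theta>\<close> in \<open>L\<close>, then it implies one of the two.  Hence the diagrams
  can be distributed over \<open>I\<close> and \<open>J\<close>.  The disjunction property follows from a slash in the style
  of Kleene and Aczel: call \<open>\<box>A\<close> true if \<open>\<delta> \<rightarrow> \<box>A\<close> is in \<open>L\<close> (and, for logics containing the schema
  T, if moreover \<open>A\<close> is true).  All theorems of \<open>L\<close> are true in this sense, and so is \<open>\<delta>\<close>.\<close>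

section \<open>Propositional consequence inside a normal logic\<close>

lemma normal_logic_tautological_consequence:
  assumes "finite X" "X \<subseteq> normal_logic Ax"
    and "\<And>a b. (\<forall>A\<in>X. prop_eval a b A) \<Longrightarrow> prop_eval a b C"
  shows "C \<in> normal_logic Ax"
  using assms
proof (induction X arbitrary: C rule: finite_induct)
  case empty
  then show ?case by (auto intro: normal_logic.Taut simp: tautology_def)
next
  case (insert A X)
  \<comment> \<open>The premise \<open>A\<close> becomes an antecedent of the conclusion, so the
    induction hypothesis applies to the premises left in \<open>X\<close>.\<close>
  have "A \<^bold>\<rightarrow> C \<in> normal_logic Ax"
    using insert.prems by (intro insert.IH) auto
  then show ?case using insert.prems(1) by (blast intro: normal_logic.MP)
qed

lemma normal_logic_consequence1:
  assumes "A \<in> normal_logic Ax" "\<And>a b. prop_eval a b A \<Longrightarrow> prop_eval a b C"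
  shows "C \<in> normal_logic Ax"
  by (rule normal_logic_tautological_consequence[of "{A}"]) (use assms in auto)

lemma normal_logic_consequence2:
  assumes "A \<in> normal_logic Ax" "B \<in> normal_logic Ax"
    and "\<And>a b. prop_eval a b A \<Longrightarrow> prop_eval a b B \<Longrightarrow> prop_eval a b C"
  shows "C \<in> normal_logic Ax"
  by (rule normal_logic_tautological_consequence[of "{A, B}"]) (use assms in auto)

lemma normal_logic_consequence3:
  assumes "A \<in> normal_logic Ax" "B \<in> normal_logic Ax" "C \<in> normal_logic Ax"
    and "\<And>a b. prop_eval a b A \<Longrightarrow> prop_eval a b B \<Longrightarrow> prop_eval a b C \<Longrightarrow> prop_eval a b D"
  shows "D \<in> normal_logic Ax"
  by (rule normal_logic_tautological_consequence[of "{A, B, C}"]) (use assms in auto)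

section \<open>The slash and its soundness\<close>

primrec slash :: "bool \<Rightarrow> fm set \<Rightarrow> fm \<Rightarrow> (nat \<Rightarrow> bool) \<Rightarrow> fm \<Rightarrow> bool" where
  "slash r L d a (Atom p) \<longleftrightarrow> a p"
| "slash r L d a Top \<longleftrightarrow> True"
| "slash r L d a Bot \<longleftrightarrow> False"
| "slash r L d a (A \<^bold>\<and> B) \<longleftrightarrow> slash r L d a A \<and> slash r L d a B"
| "slash r L d a (A \<^bold>\<or> B) \<longleftrightarrow> slash r L d a A \<or> slash r L d a B"
| "slash r L d a (A \<^bold>\<rightarrow> B) \<longleftrightarrow> (slash r L d a A \<longrightarrow> slash r L d a B)"
| "slash r L d a (\<^bold>\<box> A) \<longleftrightarrow> d \<^bold>\<rightarrow> \<^bold>\<box> A \<in> L \<and> (r \<longrightarrow> slash r L d a A)"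

text \<open>Implication is material in the slash, so the slash is an ordinary truth assignment with
  its own values for boxes; hence it makes every tautology true.\<close>

lemma slash_eq_prop_eval:
  "slash r L d a A \<longleftrightarrow> prop_eval a (\<lambda>B. slash r L d a (\<^bold>\<box> B)) A"
  by (induction A) auto

text \<open>Consistency of \<open>d\<close> serves the schema D: with \<open>r\<close> false, an
  inconsistent \<open>d\<close> would make both \<open>Box B\<close> and \<open>Box (Neg B)\<close>
  true.\<close>

definition slash_sound :: "bool \<Rightarrow> fm set \<Rightarrow> bool" where
  "slash_sound r Ax \<longleftrightarrow>
    (\<forall>d a. d \<^bold>\<rightarrow> Bot \<notin> normal_logic Ax \<longrightarrow> (\<forall>A\<in>Ax. slash r (normal_logic Ax) d a A))"

lemma slash_normal_logic:
  assumes "slash_sound r Ax" "d \<^bold>\<rightarrow> Bot \<notin> normal_logic Ax" "A \<in> normal_logic Ax"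
  shows "slash r (normal_logic Ax) d a A"
  using assms(3)
proof induction
  case (Taut A)
  then show ?case by (subst slash_eq_prop_eval) (simp add: tautology_def)
next
  case (Distr A B)
  \<comment> \<open>This is the derivability half of the box clause; the half guarded by
    \<open>r\<close> is modus ponens for the slash.\<close>
  have "d \<^bold>\<rightarrow> \<^bold>\<box> B \<in> normal_logic Ax"
    if "d \<^bold>\<rightarrow> \<^bold>\<box> (A \<^bold>\<rightarrow> B) \<in> normal_logic Ax" "d \<^bold>\<rightarrow> \<^bold>\<box> A \<in> normal_logic Ax"
    by (rule normal_logic_consequence3[OF that normal_logic.Distr[of A B]]) auto
  then show ?case by auto
next
  case (Axiom A)
  then show ?case using assms(1,2) by (auto simp: slash_sound_def)
next
  case (MP A B)
  then show ?case by auto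
next
  case (Nec A)
  have "d \<^bold>\<rightarrow> \<^bold>\<box> A \<in> normal_logic Ax"
    by (rule normal_logic_consequence1[OF normal_logic.Nec[OF Nec.hyps]]) auto
  then show ?case using Nec.IH by auto
qed

section \<open>Subformulas, finite conjunctions and disjunctions\<close>

primrec subformulas :: "fm \<Rightarrow> fm list" where
  "subformulas (Atom p) = [Atom p]"
| "subformulas Top = [Top]"
| "subformulas Bot = [Bot]"
| "subformulas (A \<^bold>\<and> B) = (A \<^bold>\<and> B) # subformulas A @ subformulas B"
| "subformulas (A \<^bold>\<or> B) = (A \<^bold>\<or> B) # subformulas A @ subformulas B"
| "subformulas (A \<^bold>\<rightarrow> B) = (A \<^bold>\<rightarrow> B) # subformulas A @ subformulas B"
| "subformulas (\<^bold>\<box> A) = (\<^bold>\<box> A) # subformulas A"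

lemma subformulas_refl [simp]: "A \<in> set (subformulas A)"
  by (cases A) auto

lemma immediate_subformulas:
  "A \<^bold>\<and> B \<in> set (subformulas C) \<Longrightarrow> A \<in> set (subformulas C) \<and> B \<in> set (subformulas C)"
  "A \<^bold>\<or> B \<in> set (subformulas C) \<Longrightarrow> A \<in> set (subformulas C) \<and> B \<in> set (subformulas C)"
  "A \<^bold>\<rightarrow> B \<in> set (subformulas C) \<Longrightarrow> A \<in> set (subformulas C) \<and> B \<in> set (subformulas C)"
  "\<^bold>\<box> A \<in> set (subformulas C) \<Longrightarrow> A \<in> set (subformulas C)"
  by (induction C) auto

lemma V_subformulas: "A \<in> set (subformulas B) \<Longrightarrow> V A \<subseteq> V B"
  by (induction B) auto

lemma monotone_subformulas: "A \<in> set (subformulas B) \<Longrightarrow> monotone_fm B \<Longrightarrow> monotone_fm A"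
  by (induction B) auto

definition conjs :: "fm list \<Rightarrow> fm" where "conjs As = foldr Conj As Top"
definition disjs :: "fm list \<Rightarrow> fm" where "disjs As = foldr Disj As Bot"

lemma prop_eval_conjs [simp]: "prop_eval a b (conjs As) \<longleftrightarrow> (\<forall>A\<in>set As. prop_eval a b A)"
  and V_conjs [simp]: "V (conjs As) = (\<Union>A\<in>set As. V A)"
  and monotone_conjs [simp]: "monotone_fm (conjs As) \<longleftrightarrow> (\<forall>A\<in>set As. monotone_fm A)"
  by (induction As) (auto simp: conjs_def)

lemma slash_conjs [simp]: "slash r L d a (conjs As) \<longleftrightarrow> (\<forall>A\<in>set As. slash r L d a A)"
  by (induction As) (auto simp: conjs_def)

lemma prop_eval_disjs [simp]: "prop_eval a b (disjs As) \<longleftrightarrow> (\<exists>A\<in>set As. prop_eval a b A)"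
  and V_disjs [simp]: "V (disjs As) = (\<Union>A\<in>set As. V A)"
  and monotone_disjs [simp]: "monotone_fm (disjs As) \<longleftrightarrow> (\<forall>A\<in>set As. monotone_fm A)"
  by (induction As) (auto simp: disjs_def)

lemma disjs_imp_normal_logic:
  assumes "\<And>A. A \<in> set As \<Longrightarrow> A \<^bold>\<rightarrow> C \<in> normal_logic Ax"
  shows "disjs As \<^bold>\<rightarrow> C \<in> normal_logic Ax"
  by (rule normal_logic_tautological_consequence[of "(\<lambda>A. A \<^bold>\<rightarrow> C) ` set As"])
    (use assms in auto)

section \<open>Diagrams and their disjunction property\<close>

definition diagram :: "bool \<Rightarrow> fm \<Rightarrow> fm set \<Rightarrow> fm" where
  "diagram mon \<phi> T = conjs (filter (\<lambda>A. A \<in> T) (subformulas \<phi>)) \<^bold>\<and>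
     (if mon then Top else conjs (map Neg (filter (\<lambda>A. A \<notin> T) (subformulas \<phi>))))"

text \<open>Under \<open>r\<close> the slash of a box also demands its body. The closure clause
  prevents a diagram from listing a box whose body the slash refutes.\<close>

definition truth_set :: "bool \<Rightarrow> fm \<Rightarrow> fm set \<Rightarrow> bool" where
  "truth_set r \<phi> T \<longleftrightarrow> (\<exists>a b. T = {A \<in> set (subformulas \<phi>). prop_eval a b A} \<and>
     (r \<longrightarrow> (\<forall>A. \<^bold>\<box> A \<in> T \<longrightarrow> A \<in> T)))"

text \<open>A truth lemma by induction on subformulas: members of \<open>T\<close> are slashed. If
  the diagram has negations, the converse holds too, since a false subformula derivable from the
  diagram would make it inconsistent.\<close>

lemma slash_diagram:
  assumes T: "truth_set r \<phi> T"
    and mon: "mon \<Longrightarrow> monotone_fm \<phi>"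
    and cons: "diagram mon \<phi> T \<^bold>\<rightarrow> Bot \<notin> normal_logic Ax"
  shows "slash r (normal_logic Ax) (diagram mon \<phi> T) (\<lambda>p. Atom p \<in> T) (diagram mon \<phi> T)"
proof -
  let ?d = "diagram mon \<phi> T"
  let ?S = "slash r (normal_logic Ax) ?d (\<lambda>p. Atom p \<in> T)"
  obtain a b where ab: "T = {A \<in> set (subformulas \<phi>). prop_eval a b A}"
    and refl: "r \<Longrightarrow> \<^bold>\<box> A \<in> T \<Longrightarrow> A \<in> T" for A
    using T unfolding truth_set_def by blast
  have pos: "?d \<^bold>\<rightarrow> A \<in> normal_logic Ax" if "A \<in> T" for A
    using that ab by (intro normal_logic.Taut) (auto simp: tautology_def diagram_def)
  have neg: "?d \<^bold>\<rightarrow> A \<notin> normal_logic Ax"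
    if "\<not> mon" "A \<in> set (subformulas \<phi>)" "A \<notin> T" for A
  proof
    assume "?d \<^bold>\<rightarrow> A \<in> normal_logic Ax"
    then have "?d \<^bold>\<rightarrow> Bot \<in> normal_logic Ax"
      by (rule normal_logic_consequence1) (use that in \<open>auto simp: diagram_def\<close>)
    with cons show False ..
  qed
  have truth: "(A \<in> T \<longrightarrow> ?S A) \<and> (\<not> mon \<longrightarrow> ?S A \<longrightarrow> A \<in> T)"
    if "A \<in> set (subformulas \<phi>)" for A
    using that
  proof (induction A)
    case (Conj A B)
    then show ?case using immediate_subformulas(1)[OF Conj.prems] ab by auto
  next
    case (Disj A B)
    then show ?case using immediate_subformulas(2)[OF Disj.prems] ab by auto
  next
    case (Imp A B)
    \<comment> \<open>An implication needs the converse direction for its antecedent, which is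
      available only if not \<open>mon\<close>; a monotone \<phi> has no implication among its
      subformulas.\<close>
    then have "\<not> mon" using mon monotone_subformulas by fastforce
    then show ?case using Imp immediate_subformulas(3)[OF Imp.prems] ab by auto
  next
    case (Box A)
    then show ?case using immediate_subformulas(4)[OF Box.prems] pos neg refl by auto
  qed (use ab in auto)
  \<comment> \<open>Only the slashed formula is written out; the parameter \<open>?d\<close> inside
    \<open>?S\<close> stays folded so that \<open>truth\<close> matches.\<close>
  have "?S (conjs (filter (\<lambda>A. A \<in> T) (subformulas \<phi>)) \<^bold>\<and>
      (if mon then Top else conjs (map Neg (filter (\<lambda>A. A \<notin> T) (subformulas \<phi>)))))"
    using truth by (cases mon) auto
  then show ?thesis by (simp only: diagram_def)
qed

text \<open>An inconsistent diagram implies anything. A consistent one is slashed, as is the given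
  theorem, so one of the boxes is slashed, hence derivable from the diagram.\<close>

lemma diagram_disjunction_property:
  assumes "slash_sound r Ax" "truth_set r \<phi> T" "mon \<Longrightarrow> monotone_fm \<phi>"
    and disj: "diagram mon \<phi> T \<^bold>\<rightarrow> \<^bold>\<box> \<psi> \<^bold>\<or> \<^bold>\<box> \<theta> \<in> normal_logic Ax"
  shows "diagram mon \<phi> T \<^bold>\<rightarrow> \<^bold>\<box> \<psi> \<in> normal_logic Ax \<or> diagram mon \<phi> T \<^bold>\<rightarrow> \<^bold>\<box> \<theta> \<in> normal_logic Ax"
proof (cases "diagram mon \<phi> T \<^bold>\<rightarrow> Bot \<in> normal_logic Ax")
  case True
  then have "diagram mon \<phi> T \<^bold>\<rightarrow> \<^bold>\<box> \<psi> \<in> normal_logic Ax"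
    by (rule normal_logic_consequence1) auto
  then show ?thesis ..
next
  case False
  show ?thesis
    using slash_normal_logic[OF assms(1) False disj] slash_diagram[OF assms(2,3) False] by auto
qed

section \<open>Construction of the interpolants\<close>

lemma modal_disjunctive_interpolants:
  assumes sound: "slash_sound r Ax"
    and refl: "r \<Longrightarrow> ax_T \<subseteq> Ax"
    and mon: "mon \<Longrightarrow> monotone_fm \<phi>"
    and disj: "\<phi> \<^bold>\<rightarrow> \<^bold>\<box> \<psi> \<^bold>\<or> \<^bold>\<box> \<theta> \<in> normal_logic Ax"
  shows "\<exists>I J. is_MDI (normal_logic Ax) \<phi> \<psi> \<theta> (I, J) \<and>
    (mon \<longrightarrow> monotone_fm I \<and> monotone_fm J)"
proof -
  let ?L = "normal_logic Ax"
  define D where "D = diagram mon \<phi> ` {T. truth_set r \<phi> T \<and> \<phi> \<in> T}"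
  have "finite {T. truth_set r \<phi> T \<and> \<phi> \<in> T}"
    by (rule finite_subset[of _ "Pow (set (subformulas \<phi>))"]) (auto simp: truth_set_def)
  then have "finite D" unfolding D_def by (rule finite_imageI)
  then obtain ds where ds: "set ds = D"
    using finite_list by metis
  define I where "I = disjs (filter (\<lambda>d. d \<^bold>\<rightarrow> \<^bold>\<box> \<psi> \<in> ?L) ds)"
  \<comment> \<open>A diagram implying both boxes goes to \<open>I\<close>; those left for
    \<open>J\<close> imply the second box by \<open>split\<close>.\<close>
  define J where "J = disjs (filter (\<lambda>d. d \<^bold>\<rightarrow> \<^bold>\<box> \<psi> \<notin> ?L) ds)"
  have split: "d \<^bold>\<rightarrow> \<^bold>\<box> \<psi> \<in> ?L \<or> d \<^bold>\<rightarrow> \<^bold>\<box> \<theta> \<in> ?L" if d: "d \<in> D" for d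
  proof -
    obtain T where T: "truth_set r \<phi> T" "\<phi> \<in> T" "d = diagram mon \<phi> T"
      using d unfolding D_def by blast
    \<comment> \<open>Since \<phi> is in \<open>T\<close>, it is a conjunct of
      \<open>d\<close>.\<close>
    have "d \<^bold>\<rightarrow> \<^bold>\<box> \<psi> \<^bold>\<or> \<^bold>\<box> \<theta> \<in> ?L"
      by (rule normal_logic_consequence1[OF disj]) (use T in \<open>auto simp: diagram_def\<close>)
    then show ?thesis
      using diagram_disjunction_property[OF sound T(1) mon] T(3) by blast
  qed
  have "V d \<subseteq> V \<phi>" if "d \<in> D" for d
    using that V_subformulas by (fastforce simp: D_def diagram_def split: if_splits)
  then have "V I \<subseteq> V \<phi>" "V J \<subseteq> V \<phi>"
    using ds by (auto simp: I_def J_def)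
  moreover have "monotone_fm d" if mon "d \<in> D" for d
    using that mon monotone_subformulas by (auto simp: D_def diagram_def)
  then have "mon \<longrightarrow> monotone_fm I \<and> monotone_fm J"
    using ds by (auto simp: I_def J_def)
  moreover have "I \<^bold>\<rightarrow> \<^bold>\<box> \<psi> \<in> ?L"
    unfolding I_def by (rule disjs_imp_normal_logic) simp
  moreover have "J \<^bold>\<rightarrow> \<^bold>\<box> \<theta> \<in> ?L"
    unfolding J_def by (rule disjs_imp_normal_logic) (use split ds in auto)
  moreover have "\<phi> \<^bold>\<rightarrow> (I \<^bold>\<or> J) \<in> ?L"
  proof -
    \<comment> \<open>Under \<open>r\<close> an arbitrary assignment need not yield a truth set. The
      finitely many instances of T in \<open>X\<close>, taken as premises, force the missing
      closure.\<close>
    define X where "X = (if r then (\<lambda>A. \<^bold>\<box> A \<^bold>\<rightarrow> A) ` set (subformulas \<phi>) else {})"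
    show ?thesis
    proof (rule normal_logic_tautological_consequence[of X])
      show "finite X" by (simp add: X_def)
      show "X \<subseteq> ?L"
        using refl by (auto simp: X_def ax_T_def intro!: normal_logic.Axiom)
      fix a b assume X: "\<forall>A\<in>X. prop_eval a b A"
      define T where "T = {A \<in> set (subformulas \<phi>). prop_eval a b A}"
      have "r \<longrightarrow> (\<forall>A. \<^bold>\<box> A \<in> T \<longrightarrow> A \<in> T)"
        using X by (auto simp: X_def T_def dest: immediate_subformulas(4))
      then have "truth_set r \<phi> T"
        unfolding truth_set_def T_def by blast
      then have "diagram mon \<phi> T \<in> set ds" if "prop_eval a b \<phi>"
        using that ds by (auto simp: D_def T_def)
      moreover have "prop_eval a b (diagram mon \<phi> T)"
        by (auto simp: diagram_def T_def)
      ultimately show "prop_eval a b (\<phi> \<^bold>\<rightarrow> (I \<^bold>\<or> J))"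
        by (auto simp: I_def J_def)
    qed
  qed
  ultimately show ?thesis by (auto simp: is_MDI_def)
qed

lemma MDIP_mMDIP_normal_logic:
  assumes "slash_sound r Ax" "r \<Longrightarrow> ax_T \<subseteq> Ax"
  shows "MDIP (normal_logic Ax) \<and> mMDIP (normal_logic Ax)"
proof
  show "MDIP (normal_logic Ax)"
    unfolding MDIP_def using modal_disjunctive_interpolants[OF assms, of False] by blast
  show "mMDIP (normal_logic Ax)"
    unfolding mMDIP_def is_mMDI_def
    using modal_disjunctive_interpolants[OF assms, of True] by fastforce
qed

section \<open>Soundness of the axiom schemata and the seven logics\<close>

lemma slash_ax_D:
  assumes "ax_D \<subseteq> Ax" "A \<in> ax_D" "d \<^bold>\<rightarrow> Bot \<notin> normal_logic Ax"
  shows "slash False (normal_logic Ax) d a A"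
proof -
  obtain B where B: "A = \<^bold>\<box> B \<^bold>\<rightarrow> \<^bold>\<diamond> B" using assms(2) by (auto simp: ax_D_def)
  have "A \<in> normal_logic Ax" using assms(1,2) by (auto intro: normal_logic.Axiom)
  \<comment> \<open>If both boxes were derivable from \<open>d\<close>, the axiom would refute
    \<open>d\<close>.\<close>
  then have "d \<^bold>\<rightarrow> Bot \<in> normal_logic Ax"
    if "d \<^bold>\<rightarrow> \<^bold>\<box> B \<in> normal_logic Ax" "d \<^bold>\<rightarrow> \<^bold>\<box> \<^bold>\<not> B \<in> normal_logic Ax"
    by (rule normal_logic_consequence3[OF that]) (auto simp: B)
  then show ?thesis using assms(3) B by auto
qed

lemma slash_ax_T: "A \<in> ax_T \<Longrightarrow> slash True L d a A"
  by (auto simp: ax_T_def)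

text \<open>This works for either \<open>r\<close>: derivability of the double box comes from the
  axiom, and the body required under \<open>r\<close> is the slashed antecedent itself.\<close>

lemma slash_ax_4:
  assumes "ax_4 \<subseteq> Ax" "A \<in> ax_4"
  shows "slash r (normal_logic Ax) d a A"
proof -
  obtain B where B: "A = \<^bold>\<box> B \<^bold>\<rightarrow> \<^bold>\<box> \<^bold>\<box> B" using assms(2) by (auto simp: ax_4_def)
  have "A \<in> normal_logic Ax" using assms by (auto intro: normal_logic.Axiom)
  then have "d \<^bold>\<rightarrow> \<^bold>\<box> \<^bold>\<box> B \<in> normal_logic Ax" if "d \<^bold>\<rightarrow> \<^bold>\<box> B \<in> normal_logic Ax"
    by (rule normal_logic_consequence2[OF that]) (auto simp: B)
  then show ?thesis using B by auto
qed

text \<open>With \<open>r\<close> false a slashed box is just one derivable from \<open>d\<close>,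
  so the axiom itself carries derivability from antecedent to consequent.\<close>

lemma slash_ax_L:
  assumes "ax_L \<subseteq> Ax" "A \<in> ax_L"
  shows "slash False (normal_logic Ax) d a A"
proof -
  obtain B where B: "A = \<^bold>\<box> (\<^bold>\<box> B \<^bold>\<rightarrow> B) \<^bold>\<rightarrow> \<^bold>\<box> B" using assms(2) by (auto simp: ax_L_def)
  have "A \<in> normal_logic Ax" using assms by (auto intro: normal_logic.Axiom)
  then have "d \<^bold>\<rightarrow> \<^bold>\<box> B \<in> normal_logic Ax" if "d \<^bold>\<rightarrow> \<^bold>\<box> (\<^bold>\<box> B \<^bold>\<rightarrow> B) \<in> normal_logic Ax"
    by (rule normal_logic_consequence2[OF that]) (auto simp: B)
  then show ?thesis using B by auto
qed

text \<open>The flag is true exactly for the two axiom sets containing \<open>ax_T\<close>, which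
  matches the side condition of \<open>MDIP_mMDIP_normal_logic\<close>.\<close>

lemma slash_sound_axioms:
  "slash_sound False {}" "slash_sound False ax_D" "slash_sound True ax_T"
  "slash_sound False ax_4" "slash_sound False (ax_D \<union> ax_4)"
  "slash_sound True (ax_T \<union> ax_4)" "slash_sound False ax_L"
  by (auto simp: slash_sound_def intro: slash_ax_D slash_ax_T slash_ax_4 slash_ax_L)

theorem theorem5p10:
  "\<forall>L \<in> {logic_K, logic_D, logic_KT, logic_K4, logic_KD4, logic_S4, logic_GL}. MDIP L \<and> mMDIP L"
  using slash_sound_axioms[THEN MDIP_mMDIP_normal_logic]
  by (simp add: logic_K_def logic_D_def logic_KT_def logic_K4_def logic_KD4_def logic_S4_def
      logic_GL_def)

end
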